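(* Let $k\ge3$. For any $k$-gon $P$, represented by $z\in\mathbb C^k$, with centroid $0$, $$ S(P)-4\tan\left(\frac\pi k\right)F(P)\ \ge\ 2\sin^2\left(\frac\pi k\right)\left\|z+\frac{i e^{-i\frac\pi k}\,\boldsymbol t}{2\sin\left(\frac\pi k\right)}\right\|^2 . $$ Equality holds if and only if $P$ is a positively oriented regular $k$-gon.
   Context: A $k$-gon $P$ is an ordered $k$-tuple $z=(z_0,\dots,z_{k-1})\in\mathbb C^k$ of points of the plane, identified with $\mathbb C$; indices are read modulo $k$. $P$ has centroid $0$ if $\sum_{\nu=0}^{k-1}z_\nu=0$. $\|\cdot\|$ is the norm of the Hermitian inner product $\langle z,w\rangle=\sum_{\nu=0}^{k-1}z_\nu\overline{w_\nu}$. The derivative (first difference) is $\dot z=(z_1-z_0,z_2-z_1,\dots,z_0-z_{k-1})$, and $\boldsymbol t=\dot z$ is the set of tangent vectors. $S(P)=\sum_{j=0}^{k-1}|z_{j+1}-z_j|^2=\|\dot z\|^2$ is the sum of the squares of the side lengths, and $F(P)=\frac1{4i}\sum_{j=0}^{k-1}(z_{j+1}\bar z_j-z_j\bar z_{j+1})$ is the signed area. A positively oriented regular $k$-gon is a (convex) polygon with $z_\nu=c+b\,\omega^{\nu}$ for $0\le\nu\le k-1$, where $b,c\in\mathbb C$ and $\omega=e^{2\pi i/k}$ (with centroid $0$ this means $z=b\,(1,\omega,\dots,\omega^{k-1})$); the degenerate case $b=0$, all vertices coinciding, is allowed. *)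

theory Defs
  imports Complex_Main
begin

text \<open>
  A \<open>k\<close>-gon is given by \<open>k\<close> and a function \<open>z :: nat \<Rightarrow> complex\<close> of which only
  the values \<open>z 0, \<dots>, z (k - 1)\<close> are ever used; vertex indices are read modulo \<open>k\<close>.
\<close>

definition centroid_zero :: "nat \<Rightarrow> (nat \<Rightarrow> complex) \<Rightarrow> bool" where
  "centroid_zero k z \<longleftrightarrow> (\<Sum>\<nu><k. z \<nu>) = 0"

definition herm_inner :: "nat \<Rightarrow> (nat \<Rightarrow> complex) \<Rightarrow> (nat \<Rightarrow> complex) \<Rightarrow> complex" where
  "herm_inner k z w = (\<Sum>\<nu><k. z \<nu> * cnj (w \<nu>))"

definition herm_norm :: "nat \<Rightarrow> (nat \<Rightarrow> complex) \<Rightarrow> real" where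
  "herm_norm k z = sqrt (Re (herm_inner k z z))"

definition polygon_deriv :: "nat \<Rightarrow> (nat \<Rightarrow> complex) \<Rightarrow> nat \<Rightarrow> complex" where
  "polygon_deriv k z j = z ((j + 1) mod k) - z j"

definition side_squares :: "nat \<Rightarrow> (nat \<Rightarrow> complex) \<Rightarrow> real" where
  "side_squares k z = (\<Sum>j<k. (cmod (z ((j + 1) mod k) - z j))\<^sup>2)"

lemma side_squares_eq_norm_deriv: "side_squares k z = (herm_norm k (polygon_deriv k z))\<^sup>2"
proof -
  have "Re (herm_inner k w w) = (\<Sum>j<k. (cmod (w j))\<^sup>2)" for w
    by (simp add: herm_inner_def cmod_power2) (simp add: power2_eq_square)
  then show ?thesis
    by (simp add: side_squares_def herm_norm_def polygon_deriv_def sum_nonneg)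
qed

text \<open>
  The expression under \<open>Re\<close> is always real, see \<open>of_real_signed_area\<close> below.
\<close>

definition signed_area :: "nat \<Rightarrow> (nat \<Rightarrow> complex) \<Rightarrow> real" where
  "signed_area k z =
     Re (1 / (4 * \<i>) * (\<Sum>j<k. z ((j + 1) mod k) * cnj (z j) - z j * cnj (z ((j + 1) mod k))))"

lemma of_real_signed_area:
  "complex_of_real (signed_area k z) =
     1 / (4 * \<i>) * (\<Sum>j<k. z ((j + 1) mod k) * cnj (z j) - z j * cnj (z ((j + 1) mod k)))"
  (is "_ = 1 / (4 * \<i>) * ?s")
proof -
  have "Re ?s = 0"
    by (simp add: algebra_simps)
  then show ?thesis
    by (simp add: signed_area_def complex_eq_iff Re_divide Im_divide)
qed

text \<open>The degenerate case \<open>b = 0\<close> is included.\<close>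

definition pos_regular :: "nat \<Rightarrow> (nat \<Rightarrow> complex) \<Rightarrow> bool" where
  "pos_regular k z \<longleftrightarrow>
     (\<exists>b c. \<forall>\<nu><k. z \<nu> = c + b * exp (2 * of_real pi * \<i> / of_nat k) ^ \<nu>)"

end

theory Submission
  imports Defs
begin

text \<open>
  Both sides of the inequality are quadratic forms in \<open>z\<close> that are invariant under the cyclic shift
  of the vertices, so the discrete Fourier transform diagonalises both of them. Let
  \<open>\<theta> = \<pi> / k\<close> and \<open>\<omega> = e\<^bsup>2 i \<theta>\<^esup>\<close>, let \<open>N = \<Sum>\<bar>z\<^sub>j\<bar>\<^sup>2\<close> be the squared norm of
  \<open>z\<close>, and let \<open>X = \<Sum> z\<^sub>j\<^sub>+\<^sub>1 cnj z\<^sub>j\<close> be its inner product with its own shift. Every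
  quantity in the statement is a combination of \<open>N\<close> and \<open>X\<close>: the sum of the squared sides is
  \<open>2 N - 2 Re X\<close>, the area is \<open>Im X / 2\<close>, and the right-hand side is
  \<open>N - Re (e\<^bsup>- 2 i \<theta>\<^esup> X)\<close> (\<open>rotated_tangent_norm\<close>).

  By Parseval's identity, \<open>N = k \<Sum>\<bar>b\<^sub>m\<bar>\<^sup>2\<close> and \<open>X = k \<Sum> \<omega>\<^sup>m \<bar>b\<^sub>m\<bar>\<^sup>2\<close>, where
  \<open>b\<^sub>m\<close> are the Fourier coefficients of \<open>z\<close>. So the left-hand side minus the right-hand side is
  \<open>k \<Sum> \<lambda>\<^sub>m \<bar>b\<^sub>m\<bar>\<^sup>2\<close> (\<open>deficit_fourier\<close>), with eigenvalues that factor as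
  \<open>\<lambda>\<^sub>m = 2 sin a (sin (a + \<theta>) + cos a sin \<theta>) / cos \<theta>\<close> for \<open>a = (m - 1) \<theta>\<close>.
  Here \<open>\<lambda>\<^sub>1 = 0\<close>, and \<open>\<lambda>\<^sub>m > 0\<close> for \<open>2 \<le> m < k\<close> (\<open>deficit_eigenvalue_pos\<close>). The
  eigenvalue \<open>\<lambda>\<^sub>0\<close> is negative, but the centroid condition says exactly that \<open>b\<^sub>0 = 0\<close>. This
  proves the inequality, with equality exactly when all modes \<open>2 \<le> m < k\<close> vanish, that is, when
  \<open>z\<^sub>j = b\<^sub>0 + b\<^sub>1 \<omega>\<^sup>j\<close> (\<open>pos_regular_iff_fourier\<close>).
\<close>

section \<open>The discrete Fourier transform of a polygon\<close>

definition unit_root :: "nat \<Rightarrow> complex" where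
  "unit_root k = cis (2 * pi / real k)"

definition fourier_coeff :: "nat \<Rightarrow> (nat \<Rightarrow> complex) \<Rightarrow> nat \<Rightarrow> complex" where
  "fourier_coeff k z m = (\<Sum>j<k. z j * cnj (unit_root k ^ (m * j))) / of_nat k"

lemma unit_root_pow: "unit_root k ^ n = cis (2 * real n * (pi / real k))"
  by (simp add: unit_root_def DeMoivre algebra_simps)

lemma unit_root_pow_self: "k > 0 \<Longrightarrow> unit_root k ^ k = 1"
  by (simp add: unit_root_pow complex_eq_iff)

lemma unit_root_pow_successor:
  assumes "k > 0"
  shows "unit_root k ^ (m * ((j + 1) mod k)) = unit_root k ^ m * unit_root k ^ (m * j)"
proof -
  have period: "unit_root k ^ (a mod k) = unit_root k ^ a" for a
    by (metis assms unit_root_pow_self div_mult_mod_eq mult.commute mult.left_neutral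
        power_add power_mult power_one)
  have "unit_root k ^ (m * ((j + 1) mod k)) = (unit_root k ^ ((j + 1) mod k)) ^ m"
    by (simp add: power_mult[symmetric] mult.commute)
  also have "\<dots> = unit_root k ^ m * unit_root k ^ (m * j)"
    by (simp only: period) (simp add: power_mult_distrib power_mult[symmetric] mult.commute)
  finally show ?thesis .
qed

text \<open>
  The sum is geometric with ratio \<open>\<omega>\<^bsup>n - j\<^esup>\<close>, a \<open>k\<close>-th root of unity that equals 1 only if
  \<open>k\<close> divides \<open>n - j\<close>.
\<close>

lemma unit_root_orthogonal:
  assumes "n < k" "j < k"
  shows "(\<Sum>m<k. unit_root k ^ (m * n) * cnj (unit_root k ^ (m * j))) = (if n = j then of_nat k else 0)"
proof -
  define u where "u = unit_root k ^ n * cnj (unit_root k ^ j)"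
  have k: "k > 0" using assms by simp
  have u_cis: "u = cis (2 * pi * ((real n - real j) / real k))"
    by (simp add: u_def unit_root_pow cis_cnj cis_mult diff_divide_distrib algebra_simps)
  have "u ^ k = (unit_root k ^ k) ^ n * cnj ((unit_root k ^ k) ^ j)"
    by (simp add: u_def power_mult_distrib power_mult[symmetric] mult.commute)
  then have u_pow: "u ^ k = 1"
    using k by (simp only: unit_root_pow_self) simp
  have "(\<Sum>m<k. unit_root k ^ (m * n) * cnj (unit_root k ^ (m * j))) = (\<Sum>m<k. u ^ m)"
    by (simp add: u_def power_mult_distrib power_mult[symmetric] mult.commute)
  also have "\<dots> = (if n = j then of_nat k else 0)"
  proof (cases "n = j")
    case True
    then show ?thesis by (simp add: u_cis)
  next
    case False
    have "u \<noteq> 1"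
    proof
      assume "u = 1"
      then have "cos (2 * pi * ((real n - real j) / real k)) = 1"
        by (simp add: u_cis complex_eq_iff)
      then obtain x :: int where x: "2 * pi * ((real n - real j) / real k) = of_int x * 2 * pi"
        by (auto simp: cos_one_2pi_int)
      have "q = of_int x" if "2 * pi * q = of_int x * 2 * pi" for q :: real
        using that by simp
      from this[OF x] have "(real n - real j) / real k = of_int x" .
      then have "real n - real j = of_int x * real k"
        using k by (simp add: field_simps)
      then have eq: "int n - int j = x * int k"
        by (metis of_int_diff of_int_eq_iff of_int_mult of_int_of_nat_eq)
      then have "int k dvd int n - int j" by simp
      moreover have "\<bar>int n - int j\<bar> < int k" using assms by linarith
      ultimately have "int n - int j = 0"
        by (metis abs_of_nat dvd_imp_le_int linorder_not_le)
      with False show False by simp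
    qed
    then show ?thesis using False u_pow by (simp add: geometric_sum)
  qed
  finally show ?thesis .
qed

lemma fourier_inversion:
  assumes "j < k"
  shows "z j = (\<Sum>m<k. fourier_coeff k z m * unit_root k ^ (m * j))"
proof -
  have "(\<Sum>m<k. fourier_coeff k z m * unit_root k ^ (m * j))
      = (\<Sum>m<k. \<Sum>n<k. z n / of_nat k * (unit_root k ^ (m * j) * cnj (unit_root k ^ (m * n))))"
    by (simp add: fourier_coeff_def sum_divide_distrib sum_distrib_left mult_ac)
  also have "\<dots> = (\<Sum>n<k. z n / of_nat k * (\<Sum>m<k. unit_root k ^ (m * j) * cnj (unit_root k ^ (m * n))))"
    by (subst sum.swap) (simp add: sum_distrib_left)
  also have "\<dots> = (\<Sum>n<k. if j = n then z n else 0)"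
    using assms by (intro sum.cong) (auto simp only: unit_root_orthogonal lessThan_iff, auto)
  also have "\<dots> = z j" using assms by simp
  finally show ?thesis by simp
qed

text \<open>
  The coefficients are arbitrary here, so that the identity also applies to the shifted polygon, whose
  coefficients can be read off from those of \<open>z\<close>.
\<close>

lemma parseval:
  assumes x: "\<And>j. j < k \<Longrightarrow> x j = (\<Sum>m<k. a m * unit_root k ^ (m * j))"
    and y: "\<And>j. j < k \<Longrightarrow> y j = (\<Sum>m<k. c m * unit_root k ^ (m * j))"
  shows "herm_inner k x y = of_nat k * (\<Sum>m<k. a m * cnj (c m))"
proof -
  have "herm_inner k x y
      = (\<Sum>j<k. \<Sum>m<k. \<Sum>n<k. (a m * cnj (c n)) * (unit_root k ^ (j * m) * cnj (unit_root k ^ (j * n))))"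
    unfolding herm_inner_def
    by (intro sum.cong) (simp_all add: x y sum_product mult_ac)
  also have "\<dots> = (\<Sum>m<k. \<Sum>j<k. \<Sum>n<k.
      (a m * cnj (c n)) * (unit_root k ^ (j * m) * cnj (unit_root k ^ (j * n))))"
    by (rule sum.swap)
  also have "\<dots> = (\<Sum>m<k. \<Sum>n<k. (a m * cnj (c n)) *
      (\<Sum>j<k. unit_root k ^ (j * m) * cnj (unit_root k ^ (j * n))))"
    by (rule sum.cong[OF refl], subst sum.swap) (simp add: sum_distrib_left)
  also have "\<dots> = (\<Sum>m<k. \<Sum>n<k. if m = n then of_nat k * (a m * cnj (c m)) else 0)"
    by (intro sum.cong refl) (auto simp only: unit_root_orthogonal lessThan_iff, auto)
  also have "\<dots> = of_nat k * (\<Sum>m<k. a m * cnj (c m))"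
    by (simp add: sum_distrib_left)
  finally show ?thesis .
qed

section \<open>Norm and shift correlation\<close>

definition shift_correlation :: "nat \<Rightarrow> (nat \<Rightarrow> complex) \<Rightarrow> complex" where
  "shift_correlation k z = herm_inner k (\<lambda>j. z ((j + 1) mod k)) z"

text \<open>Shifting the vertices multiplies the \<open>m\<close>-th Fourier coefficient by \<open>\<omega>\<^sup>m\<close>.\<close>

lemma shift_correlation_fourier:
  "shift_correlation k z = of_nat k * (\<Sum>m<k. unit_root k ^ m * (cmod (fourier_coeff k z m))\<^sup>2)"
proof -
  have shifted: "z ((j + 1) mod k) = (\<Sum>m<k. (fourier_coeff k z m * unit_root k ^ m) * unit_root k ^ (m * j))"
    if "j < k" for j
    using that fourier_inversion[of "(j + 1) mod k" k z] 
    by (simp add: unit_root_pow_successor[simplified] mult_ac)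
  have "shift_correlation k z = of_nat k * (\<Sum>m<k. (fourier_coeff k z m * unit_root k ^ m) * cnj (fourier_coeff k z m))"
    unfolding shift_correlation_def by (rule parseval) (fact shifted, fact fourier_inversion)
  then show ?thesis unfolding complex_norm_square by (simp add: mult_ac)
qed

lemma herm_norm_squared: "(herm_norm k z)\<^sup>2 = (\<Sum>j<k. (cmod (z j))\<^sup>2)"
proof -
  have "Re (herm_inner k z z) = (\<Sum>j<k. (cmod (z j))\<^sup>2)"
    by (simp add: herm_inner_def cmod_power2) (simp add: power2_eq_square)
  then show ?thesis
    by (simp add: herm_norm_def sum_nonneg)
qed

lemma herm_norm_fourier:
  "(herm_norm k z)\<^sup>2 = real k * (\<Sum>m<k. (cmod (fourier_coeff k z m))\<^sup>2)"
proof -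
  have "complex_of_real ((herm_norm k z)\<^sup>2) = herm_inner k z z"
    unfolding herm_norm_squared herm_inner_def of_real_sum complex_norm_square ..
  also have "\<dots> = of_nat k * (\<Sum>m<k. fourier_coeff k z m * cnj (fourier_coeff k z m))"
    by (rule parseval) (fact fourier_inversion)+
  also have "\<dots> = of_real (real k * (\<Sum>m<k. (cmod (fourier_coeff k z m))\<^sup>2))"
    unfolding of_real_mult of_real_sum complex_norm_square by simp
  finally show ?thesis by (simp only: of_real_eq_iff)
qed

lemma sum_shift_mod:
  fixes f :: "nat \<Rightarrow> 'a::comm_monoid_add"
  assumes "k > 0"
  shows "(\<Sum>j<k. f ((j + 1) mod k)) = (\<Sum>j<k. f j)"
proof -
  obtain n where k: "k = Suc n" using assms gr0_conv_Suc by blast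
  have "(\<Sum>j<k. f ((j + 1) mod k)) = (\<Sum>j<n. f (Suc j)) + f 0"
    unfolding k by (simp add: sum.lessThan_Suc)
  also have "\<dots> = (\<Sum>j<k. f j)"
    by (simp only: k sum.lessThan_Suc_shift add.commute)
  finally show ?thesis .
qed

text \<open>
  The side vectors and the vectors on the right-hand side of the inequality both have the form
  \<open>\<alpha> z\<^sub>j + \<beta> z\<^sub>j\<^sub>+\<^sub>1\<close>; this formula evaluates both of them.
\<close>

lemma norm_polygon_plus_shift:
  assumes "k > 0"
  shows "(\<Sum>j<k. (cmod (\<alpha> * z j + \<beta> * z ((j + 1) mod k)))\<^sup>2)
      = ((cmod \<alpha>)\<^sup>2 + (cmod \<beta>)\<^sup>2) * (herm_norm k z)\<^sup>2 + 2 * Re (\<beta> * cnj \<alpha> * shift_correlation k z)"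
proof -
  have expand: "(cmod (\<alpha> * u + \<beta> * v))\<^sup>2
      = (cmod \<alpha>)\<^sup>2 * (cmod u)\<^sup>2 + (cmod \<beta>)\<^sup>2 * (cmod v)\<^sup>2 + 2 * Re (\<beta> * cnj \<alpha> * (v * cnj u))" for u v
    unfolding cmod_power2 by (simp add: power2_eq_square algebra_simps)
  show ?thesis
    by (simp only: expand sum.distrib sum_distrib_left[symmetric] sum_shift_mod[OF assms, of "\<lambda>j. (cmod (z j))\<^sup>2"]
        herm_norm_squared shift_correlation_def herm_inner_def Re_sum[symmetric])
      (simp add: algebra_simps)
qed

lemma side_squares_shift_correlation:
  assumes "k > 0"
  shows "side_squares k z = 2 * (herm_norm k z)\<^sup>2 - 2 * Re (shift_correlation k z)"
  using norm_polygon_plus_shift[OF assms, of "-1" z 1] by (simp add: side_squares_def)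

lemma signed_area_shift_correlation: "signed_area k z = Im (shift_correlation k z) / 2"
proof -
  have "(\<Sum>j<k. z ((j + 1) mod k) * cnj (z j) - z j * cnj (z ((j + 1) mod k)))
      = shift_correlation k z - cnj (shift_correlation k z)"
    by (simp add: shift_correlation_def herm_inner_def sum_subtractf mult.commute)
  also have "\<dots> = 2 * Im (shift_correlation k z) * \<i>" by (simp add: complex_eq_iff)
  finally show ?thesis by (simp add: signed_area_def)
qed

text \<open>
  The coefficient \<open>c = i e\<^bsup>- i \<theta>\<^esup> / (2 sin \<theta>) = (1 + i cot \<theta>) / 2\<close> of the tangent vector
  has real part 1/2. Hence \<open>1 - c\<close> is the conjugate of \<open>c\<close>, and the vector in question is
  \<open>cnj c z\<^sub>j + c z\<^sub>j\<^sub>+\<^sub>1\<close>, with two coefficients of the same modulus.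
\<close>

lemma rotated_tangent_norm:
  assumes "k > 0" and "sin \<theta> \<noteq> 0"
  shows "2 * (sin \<theta>)\<^sup>2 * (herm_norm k (\<lambda>\<nu>. z \<nu> + \<i> * exp (- \<i> * of_real \<theta>) * polygon_deriv k z \<nu>
                                      / (2 * of_real (sin \<theta>))))\<^sup>2
       = (herm_norm k z)\<^sup>2 - Re (cis (- 2 * \<theta>) * shift_correlation k z)"
proof -
  define s where "s = sin \<theta>"
  define c where "c = \<i> * cis (- \<theta>) / (2 * of_real s)"
  have s: "s \<noteq> 0" using assms by (simp add: s_def)
  have c_exp: "\<i> * exp (- \<i> * of_real \<theta>) / (2 * of_real (sin \<theta>)) = c"
    by (simp add: c_def s_def cis_conv_exp)
  have c_refl: "1 - c = cnj c"
    using s by (simp add: c_def complex_eq_iff s_def Re_divide Im_divide power2_eq_square field_simps)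
  have vertex: "z \<nu> + \<i> * exp (- \<i> * of_real \<theta>) * polygon_deriv k z \<nu> / (2 * of_real (sin \<theta>))
      = cnj c * z \<nu> + c * z ((\<nu> + 1) mod k)" for \<nu>
  proof -
    have "\<i> * exp (- \<i> * of_real \<theta>) * polygon_deriv k z \<nu> / (2 * of_real (sin \<theta>))
        = c * polygon_deriv k z \<nu>"
      by (simp only: c_exp[symmetric] times_divide_eq_left)
    then show ?thesis
      by (simp only: polygon_deriv_def c_refl[symmetric]) (simp add: algebra_simps)
  qed
  have c_norm: "(cmod c)\<^sup>2 = 1 / (4 * s\<^sup>2)"
    by (simp add: c_def norm_divide norm_mult power_divide power_mult_distrib)
  have c_sq: "c * c = - cis (- 2 * \<theta>) / of_real (4 * s\<^sup>2)"
  proof -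
    have "(\<i> * w / d) * (\<i> * w / d) = (\<i> * \<i>) * (w * w) / (d * d)" for w d :: complex
      by (simp only: times_divide_times_eq mult.assoc mult.left_commute)
    from this[of "cis (- \<theta>)" "2 * of_real s"]
    have "c * c = (\<i> * \<i>) * (cis (- \<theta>) * cis (- \<theta>)) / of_real (4 * s\<^sup>2)"
      by (simp add: c_def power2_eq_square)
    then show ?thesis by (simp only: cis_mult) simp
  qed
  have "(herm_norm k (\<lambda>\<nu>. z \<nu> + \<i> * exp (- \<i> * of_real \<theta>) * polygon_deriv k z \<nu>
            / (2 * of_real (sin \<theta>))))\<^sup>2
      = (\<Sum>j<k. (cmod (cnj c * z j + c * z ((j + 1) mod k)))\<^sup>2)"
    unfolding herm_norm_squared vertex ..
  also have "\<dots> = (herm_norm k z)\<^sup>2 / (2 * s\<^sup>2) + 2 * Re (c * c * shift_correlation k z)"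
    unfolding norm_polygon_plus_shift[OF assms(1)] c_norm complex_mod_cnj complex_cnj_cnj by simp
  also have "Re (c * c * shift_correlation k z) = - Re (cis (- 2 * \<theta>) * shift_correlation k z) / (4 * s\<^sup>2)"
    unfolding c_sq times_divide_eq_left Re_divide_of_real by simp
  finally show ?thesis
    using s unfolding s_def by (simp add: field_simps)
qed

section \<open>The deficit in Fourier coordinates\<close>

text \<open>
  The factored form of the eigenvalue, from which its sign can be read off; in the lemma after it the
  eigenvalue appears as it arises from the quadratic form.
\<close>

definition deficit_eigenvalue :: "real \<Rightarrow> nat \<Rightarrow> real" where
  "deficit_eigenvalue \<theta> m = 2 * sin ((real m - 1) * \<theta>)
     * (sin (real m * \<theta>) + cos ((real m - 1) * \<theta>) * sin \<theta>) / cos \<theta>"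

lemma deficit_eigenvalue_eq:
  assumes "cos \<theta> \<noteq> 0"
  shows "deficit_eigenvalue \<theta> m
     = 1 - 2 * Re (cis (2 * real m * \<theta>)) - 2 * tan \<theta> * Im (cis (2 * real m * \<theta>))
        + Re (cis (- 2 * \<theta>) * cis (2 * real m * \<theta>))"
proof -
  define a where "a = (real m - 1) * \<theta>"
  have m: "real m * \<theta> = a + \<theta>" "2 * real m * \<theta> = 2 * (a + \<theta>)" by (simp_all add: a_def algebra_simps)
  have eq: "- 2 * \<theta> + 2 * (a + \<theta>) = 2 * a" by simp
  have double: "cos (2 * a) = 1 - 2 * (sin a * sin a)" "sin (2 * a) = 2 * (sin a * cos a)"
    by (simp_all add: cos_double_sin sin_double power2_eq_square)
  have "cos \<theta> * (1 - 2 * cos (2 * (a + \<theta>)) - 2 * tan \<theta> * sin (2 * (a + \<theta>)) + cos (2 * a))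
     = 2 * sin a * (sin (a + \<theta>) + cos a * sin \<theta>)"
  proof -
    have t: "cos \<theta> * tan \<theta> = sin \<theta>" using assms by (simp add: tan_def)
    have "cos \<theta> * (1 - 2 * cos (2 * (a + \<theta>)) - 2 * tan \<theta> * sin (2 * (a + \<theta>)) + cos (2 * a))
       = cos \<theta> * (1 + cos (2 * a)) - 2 * (cos (2 * (a + \<theta>)) * cos \<theta> + sin (2 * (a + \<theta>)) * sin \<theta>)"
      by (simp add: t[symmetric] algebra_simps)
    also have "cos (2 * (a + \<theta>)) * cos \<theta> + sin (2 * (a + \<theta>)) * sin \<theta> = cos (2 * a + \<theta>)"
      using cos_diff[of "2 * (a + \<theta>)" \<theta>] by (simp add: add.commute)
    also have "cos \<theta> * (1 + cos (2 * a)) - 2 * cos (2 * a + \<theta>)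
        = 2 * sin a * (sin (a + \<theta>) + cos a * sin \<theta>)"
      unfolding cos_add sin_add double by (simp add: algebra_simps)
    finally show ?thesis .
  qed
  then show ?thesis
    unfolding deficit_eigenvalue_def cis_mult m eq a_def[symmetric]
    using assms by (simp add: field_simps)
qed

lemma deficit_fourier:
  assumes "k > 0" "sin (pi / real k) \<noteq> 0" "cos (pi / real k) \<noteq> 0"
  shows "side_squares k z - 4 * tan (pi / real k) * signed_area k z
           - 2 * (sin (pi / real k))\<^sup>2 *
                 (herm_norm k (\<lambda>\<nu>. z \<nu> + \<i> * exp (- \<i> * of_real (pi / real k)) * polygon_deriv k z \<nu>
                                      / (2 * of_real (sin (pi / real k)))))\<^sup>2
       = real k * (\<Sum>m<k. deficit_eigenvalue (pi / real k) m * (cmod (fourier_coeff k z m))\<^sup>2)"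
proof -
  define \<theta> where "\<theta> = pi / real k"
  define b where "b m = (cmod (fourier_coeff k z m))\<^sup>2" for m
  have norm: "(herm_norm k z)\<^sup>2 = real k * (\<Sum>m<k. b m)"
    by (simp add: herm_norm_fourier b_def)
  have corr: "Re (\<gamma> * shift_correlation k z) = real k * (\<Sum>m<k. Re (\<gamma> * cis (2 * real m * \<theta>)) * b m)" for \<gamma>
  proof -
    have "\<gamma> * shift_correlation k z = of_real (real k) * (\<Sum>m<k. \<gamma> * cis (2 * real m * \<theta>) * of_real (b m))"
      by (simp add: shift_correlation_fourier unit_root_pow b_def \<theta>_def sum_distrib_left mult_ac)
    then show ?thesis
      by (simp only: Re_complex_of_real Re_sum scaleR_conv_of_real[symmetric])
         (simp add: sum_distrib_left algebra_simps)
  qed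
  \<comment> \<open>The separate real and imaginary parts of the correlation are the cases \<open>\<gamma> = 1\<close> and \<open>\<gamma> = - i\<close>.\<close>
  have corr_Re: "Re (shift_correlation k z) = real k * (\<Sum>m<k. Re (cis (2 * real m * \<theta>)) * b m)"
    using corr[of 1] by simp
  have corr_Im: "Im (shift_correlation k z) = real k * (\<Sum>m<k. Im (cis (2 * real m * \<theta>)) * b m)"
    using corr[of "- \<i>"] by simp
  have "(\<Sum>m<k. deficit_eigenvalue \<theta> m * b m)
      = (\<Sum>m<k. b m) - 2 * (\<Sum>m<k. Re (cis (2 * real m * \<theta>)) * b m)
        - 2 * tan \<theta> * (\<Sum>m<k. Im (cis (2 * real m * \<theta>)) * b m)
        + (\<Sum>m<k. Re (cis (- 2 * \<theta>) * cis (2 * real m * \<theta>)) * b m)"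
    unfolding deficit_eigenvalue_eq[OF assms(3), folded \<theta>_def] sum_distrib_left
      sum_subtractf[symmetric] sum.distrib[symmetric]
    by (intro sum.cong) (simp_all add: algebra_simps)
  then show ?thesis
    unfolding \<theta>_def[symmetric] rotated_tangent_norm[OF assms(1,2), folded \<theta>_def]
      side_squares_shift_correlation[OF assms(1)] signed_area_shift_correlation
      b_def[symmetric] norm corr_Re corr_Im corr[of "cis (- 2 * \<theta>)"]
    by algebra
qed

text \<open>
  For \<open>2 \<le> m < k\<close> the angle \<open>a = (m - 1) \<theta>\<close> lies between \<open>\<theta>\<close> and \<open>\<pi> - 2 \<theta>\<close>. So
  \<open>a + \<theta>\<close> stays away from 0 and \<open>\<pi>\<close> by at least \<open>\<theta>\<close>, which gives
  \<open>sin (a + \<theta>) \<ge> sin \<theta>\<close>, while \<open>cos a > -1\<close>; the second factor of the eigenvalue is therefore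
  at least \<open>(1 + cos a) sin \<theta> > 0\<close>.
\<close>

lemma deficit_eigenvalue_pos:
  assumes "k \<ge> 3" "2 \<le> m" "m < k"
  shows "deficit_eigenvalue (pi / real k) m > 0"
proof -
  define \<theta> where "\<theta> = pi / real k"
  have k\<theta>: "real k * \<theta> = pi" using assms by (simp add: \<theta>_def)
  have \<theta>: "0 < \<theta>" "\<theta> < pi / 2" using assms by (auto simp: \<theta>_def field_simps)
  define a where "a = (real m - 1) * \<theta>"
  have m: "real m * \<theta> = a + \<theta>" by (simp add: a_def algebra_simps)
  have a_ge: "\<theta> \<le> a" using assms \<theta> by (simp add: a_def)
  have "(real m + 1) * \<theta> \<le> real k * \<theta>" using assms \<theta> by (intro mult_right_mono) auto
  then have a_le: "a \<le> pi - 2 * \<theta>" unfolding k\<theta> a_def by (simp add: algebra_simps)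
  have sin_a: "sin a > 0" using a_ge a_le \<theta> by (intro sin_gt_zero) auto
  have "sin (a + \<theta>) - sin \<theta> = 2 * sin (a / 2) * cos (a / 2 + \<theta>)"
    by (simp add: sin_diff_sin add_divide_distrib add.commute)
  also have "\<dots> \<ge> 0"
    using a_ge a_le \<theta> by (intro mult_nonneg_nonneg sin_ge_zero cos_ge_zero) auto
  finally have "sin (a + \<theta>) \<ge> sin \<theta>" by simp
  moreover have "cos a > - 1"
    using cos_monotone_0_pi[of a pi] a_ge a_le \<theta> by simp
  then have "(1 + cos a) * sin \<theta> > 0"
    using \<theta> sin_gt_zero[of \<theta>] by simp
  ultimately have "sin (a + \<theta>) + cos a * sin \<theta> > 0" by (simp add: algebra_simps)
  then show ?thesis
    using sin_a \<theta> cos_gt_zero[of \<theta>]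
    unfolding deficit_eigenvalue_def \<theta>_def[symmetric] m a_def[symmetric] by simp
qed

section \<open>Equality\<close>

lemma fourier_coeff_0: "fourier_coeff k z 0 = (\<Sum>j<k. z j) / of_nat k"
  by (simp add: fourier_coeff_def)

text \<open>
  A positively oriented regular polygon is a constant (mode 0) plus a multiple of the powers of
  \<open>\<omega>\<close> (mode 1).
\<close>

lemma pos_regular_iff_fourier:
  assumes "k \<ge> 2"
  shows "pos_regular k z \<longleftrightarrow> (\<forall>m. 2 \<le> m \<and> m < k \<longrightarrow> fourier_coeff k z m = 0)"
proof
  have root: "exp (2 * of_real pi * \<i> / of_nat k) = unit_root k"
    by (simp add: unit_root_def cis_conv_exp mult_ac)
  show "\<forall>m. 2 \<le> m \<and> m < k \<longrightarrow> fourier_coeff k z m = 0" if regular: "pos_regular k z"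
  proof (intro allI impI)
    fix m assume m: "2 \<le> m \<and> m < k"
    obtain b c where z: "\<forall>j<k. z j = c + b * unit_root k ^ j"
      using regular unfolding pos_regular_def root by blast
    have "(\<Sum>j<k. z j * cnj (unit_root k ^ (m * j)))
        = c * (\<Sum>j<k. unit_root k ^ (j * 0) * cnj (unit_root k ^ (j * m)))
          + b * (\<Sum>j<k. unit_root k ^ (j * 1) * cnj (unit_root k ^ (j * m)))"
      unfolding sum_distrib_left sum.distrib[symmetric]
      by (intro sum.cong) (simp_all add: z algebra_simps)
    also have "\<dots> = 0"
      using m by (subst (1 2) unit_root_orthogonal) auto
    finally show "fourier_coeff k z m = 0" by (simp add: fourier_coeff_def)
  qed
  show "pos_regular k z" if zero: "\<forall>m. 2 \<le> m \<and> m < k \<longrightarrow> fourier_coeff k z m = 0"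
  proof -
    have "z j = fourier_coeff k z 0 + fourier_coeff k z 1 * unit_root k ^ j" if "j < k" for j
    proof -
      have "z j = (\<Sum>m<k. fourier_coeff k z m * unit_root k ^ (m * j))"
        using fourier_inversion[OF that] .
      also have "\<dots> = (\<Sum>m\<in>{0, 1}. fourier_coeff k z m * unit_root k ^ (m * j))"
        using assms zero by (intro sum.mono_neutral_right) (auto simp: not_less_eq_eq)
      finally show ?thesis by simp
    qed
    then show ?thesis unfolding pos_regular_def root by blast
  qed
qed

theorem theorem3:
  fixes k :: nat and z :: "nat \<Rightarrow> complex"
  assumes "k \<ge> 3"
    and "centroid_zero k z"
  shows "side_squares k z - 4 * tan (pi / real k) * signed_area k z
             \<ge> 2 * (sin (pi / real k))\<^sup>2 *
                 (herm_norm k (\<lambda>\<nu>. z \<nu> + \<i> * exp (- \<i> * of_real (pi / real k)) * polygon_deriv k z \<nu>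
                                      / (2 * of_real (sin (pi / real k)))))\<^sup>2
         \<and> (side_squares k z - 4 * tan (pi / real k) * signed_area k z
             = 2 * (sin (pi / real k))\<^sup>2 *
                 (herm_norm k (\<lambda>\<nu>. z \<nu> + \<i> * exp (- \<i> * of_real (pi / real k)) * polygon_deriv k z \<nu>
                                      / (2 * of_real (sin (pi / real k)))))\<^sup>2
            \<longleftrightarrow> pos_regular k z)"
proof -
  define \<theta> where "\<theta> = pi / real k"
  define rhs where "rhs = 2 * (sin \<theta>)\<^sup>2 *
                 (herm_norm k (\<lambda>\<nu>. z \<nu> + \<i> * exp (- \<i> * of_real \<theta>) * polygon_deriv k z \<nu>
                                      / (2 * of_real (sin \<theta>))))\<^sup>2"
  define lhs where "lhs = side_squares k z - 4 * tan \<theta> * signed_area k z"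
  define summand where "summand m = deficit_eigenvalue \<theta> m * (cmod (fourier_coeff k z m))\<^sup>2" for m
  have \<theta>: "0 < \<theta>" "\<theta> < pi / 2" using assms by (auto simp: \<theta>_def field_simps)
  have deficit: "lhs - rhs = real k * (\<Sum>m<k. summand m)"
    using deficit_fourier[of k z] assms sin_gt_zero[of \<theta>] cos_gt_zero[of \<theta>] \<theta>
    unfolding lhs_def rhs_def summand_def \<theta>_def by simp
  \<comment> \<open>Mode 0 vanishes because of its coefficient, mode 1 because of its eigenvalue.\<close>
  have summand_eq_0: "summand m = 0" if "m < 2" for m
  proof -
    have "m = 0 \<or> m = 1" using that by auto
    then show ?thesis
      using assms by (auto simp: summand_def fourier_coeff_0 centroid_zero_def deficit_eigenvalue_def)
  qed
  have eigenvalue: "deficit_eigenvalue \<theta> m > 0" if "2 \<le> m" "m < k" for m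
    using deficit_eigenvalue_pos[OF assms(1) that] by (simp add: \<theta>_def)
  have summand_nonneg: "summand m \<ge> 0" if "m < k" for m
  proof (cases "m < 2")
    case False
    then show ?thesis using eigenvalue[of m] that by (simp add: summand_def)
  qed (simp add: summand_eq_0)
  have "lhs \<ge> rhs"
    using deficit sum_nonneg[of "{..<k}" summand] summand_nonneg
    by (metis diff_ge_0_iff_ge lessThan_iff mult_nonneg_nonneg of_nat_0_le_iff)
  moreover have "lhs = rhs \<longleftrightarrow> pos_regular k z"
  proof -
    have "lhs = rhs \<longleftrightarrow> (\<Sum>m<k. summand m) = 0" using deficit assms by auto
    also have "\<dots> \<longleftrightarrow> (\<forall>m<k. summand m = 0)"
      using summand_nonneg by (subst sum_nonneg_eq_0_iff) auto
    also have "\<dots> \<longleftrightarrow> (\<forall>m. 2 \<le> m \<and> m < k \<longrightarrow> summand m = 0)"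
      using summand_eq_0 by (meson not_le)
    also have "\<dots> \<longleftrightarrow> (\<forall>m. 2 \<le> m \<and> m < k \<longrightarrow> fourier_coeff k z m = 0)"
      using eigenvalue by (force simp: summand_def)
    also have "\<dots> \<longleftrightarrow> pos_regular k z"
      using assms by (simp add: pos_regular_iff_fourier)
    finally show ?thesis .
  qed
  ultimately show ?thesis unfolding lhs_def rhs_def \<theta>_def by blast
qed

end
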